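(* Let $d\geq 2$ be an integer, let $c_1,\dots,c_s\in\mathbb{Z}$, and let $G=\langle x^d+c_1,\dots,x^d+c_s\rangle$ be the semigroup generated by these polynomials under composition. Assume that $G$ contains a polynomial that is irreducible over $\mathbb{Q}$. Then there is a polynomial $f(x)=x^d+c$ in $G$ that is irreducible over $\mathbb{Q}$, and the following statements hold: (1) If $d=2$, then either $\{f^4\circ g: g\in G\}$ is a set of irreducible polynomials in $\mathbb{Q}[x]$, or $f$ has a powered fixed point or a powered $2$-cycle. (2) If $d\geq 3$, then either $\{f^3\circ g: g\in G\}$ is a set of irreducible polynomials in $\mathbb{Q}[x]$, or $f$ has a powered fixed point.
   Context: For polynomials $f_1,\dots,f_s$, $\langle f_1,\dots,f_s\rangle$ denotes the set of all finite nonempty compositions of the $f_i$ (with repetition allowed), and $f^n$ denotes the $n$-th iterate of $f$. For $f(x)=x^d+c$ with $c\in\mathbb{Q}$: $f$ has a powered fixed point if there exist $y\in\mathbb{Q}$ and a prime $p\mid d$ such that $f(y^p)=y^p$; $f$ has a powered $2$-cycle if there exist $y\in\mathbb{Q}$ and a prime $p\mid d$ such that $f(f(y^p))=y^p$ and $f(y^p)\neq y^p$. *)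

theory Defs
  imports "HOL-Computational_Algebra.Computational_Algebra"
begin

definition unicritical :: "nat \<Rightarrow> rat \<Rightarrow> rat poly" where
  "unicritical d c = monom 1 d + [:c:]"

text \<open>All compositions of one or more (possibly repeated) members of \<open>S\<close>; the identity
  polynomial is in general not a member.\<close>

inductive_set comp_semigroup :: "rat poly set \<Rightarrow> rat poly set" for S :: "rat poly set" where
  gen: "f \<in> S \<Longrightarrow> f \<in> comp_semigroup S"
| comp: "f \<in> comp_semigroup S \<Longrightarrow> g \<in> comp_semigroup S \<Longrightarrow> f \<circ>\<^sub>p g \<in> comp_semigroup S"

definition poly_iterate :: "rat poly \<Rightarrow> nat \<Rightarrow> rat poly" where
  "poly_iterate f n = ((\<lambda>q. f \<circ>\<^sub>p q) ^^ n) [:0, 1:]"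

definition has_powered_fixed_point :: "nat \<Rightarrow> rat \<Rightarrow> bool" where
  "has_powered_fixed_point d c \<longleftrightarrow>
     (\<exists>(y::rat) p::nat. prime p \<and> p dvd d \<and> poly (unicritical d c) (y ^ p) = y ^ p)"

definition has_powered_2_cycle :: "nat \<Rightarrow> rat \<Rightarrow> bool" where
  "has_powered_2_cycle d c \<longleftrightarrow>
     (\<exists>(y::rat) p::nat. prime p \<and> p dvd d \<and>
        poly (unicritical d c) (poly (unicritical d c) (y ^ p)) = y ^ p \<and>
        poly (unicritical d c) (y ^ p) \<noteq> y ^ p)"

end

theory Submission
  imports Defs "Jordan_Normal_Form.Char_Poly"
begin

text \<open>
  The outermost factor of an irreducible composition is irreducible, so some generator
  \<open>f = x\<^sup>d + k\<close> of the semigroup is irreducible (\<open>irreducible_generator\<close>).  The rest depends on one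
  irreducibility criterion and on estimates for perfect powers in integer orbits of \<open>f\<close>.

  The criterion is a weak form of Capelli's theorem (\<open>reducible_pcompose_unicritical\<close>): if \<open>F\<close> is
  monic and irreducible but \<open>F \<circ> (x\<^sup>d + c)\<close> is not, then \<open>F(c)\<close> is a \<open>p\<close>-th power in \<open>\<rat>\<close> for some
  prime \<open>p\<close> dividing \<open>d\<close> (with even degree of \<open>F\<close> required when \<open>d\<close> is even).  A polynomial that is
  irreducible and has no such powers among its values at integers keeps both properties when it is
  composed with a generator, because the generators map integers to integers.  Hence it keeps them
  under composition with every \<open>g\<close> in the semigroup, and only \<open>f\<^sup>3\<close> (or \<open>f\<^sup>4\<close> for \<open>d = 2\<close>) has to be
  examined.  Irreducibility of this iterate follows from the same criterion once the critical orbit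
  \<open>f(k), f(f(k)), \<dots>\<close> is known to contain no powers up to that point.

  Now suppose \<open>f\<^sup>3(a) = y\<^sup>p\<close> with an integer \<open>a\<close>, and put \<open>W = f(a)\<close>, \<open>X = f(W)\<close>.  Then \<open>y\<^sup>p\<close> and
  \<open>X\<^sup>d\<close> are distinct \<open>p\<close>-th powers at distance \<open>\<bar>k\<bar>\<close>, and as large powers are far apart, \<open>X\<close> is
  small compared with \<open>k\<close>.  Therefore \<open>W\<^sup>d = X - k\<close> is close to \<open>-k\<close>, which also makes \<open>W\<close> small.
  Subtracting the two defining equations gives \<open>a\<^sup>d - W\<^sup>d = W - X\<close>, a distance too small for
  distinct \<open>d\<close>-th powers when \<open>d \<ge> 3\<close>.  So \<open>W = X\<close>, that is, \<open>X\<close> is fixed by \<open>f\<close>, and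
  \<open>X = f(X) = y\<^sup>p\<close> is a powered fixed point (\<open>third_iterate_power\<close>).  For \<open>d = 2\<close> the gaps between
  squares grow only linearly; one more iterate is needed, and neighbouring squares do occur, namely
  in the configuration of a powered 2-cycle (\<open>fourth_iterate_square\<close>).
\<close>

section \<open>Irreducibility of H(x^d)\<close>

text \<open>
  The regular representation: this is the matrix of multiplication by \<open>g\<close> on the quotient of the
  polynomial ring by \<open>A\<close>, in the basis of the powers of \<open>x\<close> below \<open>degree A\<close>.
\<close>

definition mult_mat :: "'a::field poly \<Rightarrow> 'a poly \<Rightarrow> 'a mat" where
  "mult_mat A g = mat (degree A) (degree A) (\<lambda>(i, j). coeff (g * monom 1 j mod A) i)"

lemma mult_mat_carrier [simp]: "mult_mat A g \<in> carrier_mat (degree A) (degree A)"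
  and mult_mat_dim [simp]: "dim_row (mult_mat A g) = degree A" "dim_col (mult_mat A g) = degree A"
  by (auto simp: mult_mat_def)

lemma mult_mat_add: "mult_mat A (g + h) = mult_mat A g + mult_mat A h"
  by (rule eq_matI) (auto simp: mult_mat_def distrib_right poly_mod_add_left)

lemma mult_mat_smult: "mult_mat A (Polynomial.smult a g) = a \<cdot>\<^sub>m mult_mat A g"
  by (rule eq_matI) (auto simp: mult_mat_def mod_smult_left)

lemma mult_mat_one: "mult_mat A 1 = 1\<^sub>m (degree A)"
  by (rule eq_matI) (auto simp: mult_mat_def mod_poly_less degree_monom_eq)

lemma mult_mat_const: "mult_mat A [:a:] = a \<cdot>\<^sub>m 1\<^sub>m (degree A)"
  using mult_mat_smult[of A a 1] by (simp add: mult_mat_one)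

lemma const_sum: "[:\<Sum>i\<in>S. f i:] = (\<Sum>i\<in>S. [:f i:])"
  by (rule poly_eqI) (simp add: coeff_sum coeff_pCons split: nat.split)

lemma poly_mod_sum: "(\<Sum>i\<in>S. f i) mod (A::'a::field poly) = (\<Sum>i\<in>S. f i mod A)"
  by (induction S rule: infinite_finite_induct) (auto simp: poly_mod_add_left)

lemma mult_mat_mult: "mult_mat A (g * h) = mult_mat A g * mult_mat A h"
proof (rule eq_matI)
  fix i j assume "i < dim_row (mult_mat A g * mult_mat A h)" "j < dim_col (mult_mat A g * mult_mat A h)"
  hence ij: "i < degree A" "j < degree A" by auto
  define r where "r = h * monom 1 j mod A"
  have "degree r < degree A"
    unfolding r_def using ij degree_mod_less[of A "h * monom 1 j"] by force
  have "coeff (g * h * monom 1 j mod A) i = coeff (g * r mod A) i"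
    by (simp add: r_def mod_mult_right_eq mult.assoc)
  also have "r = (\<Sum>k<degree A. Polynomial.smult (coeff r k) (monom 1 k))"
    using \<open>degree r < degree A\<close>
    by (intro poly_eqI) (auto simp: coeff_sum coeff_eq_0 if_distrib cong: if_cong)
  also have "coeff (g * \<dots> mod A) i = (\<Sum>k<degree A. coeff r k * coeff (g * monom 1 k mod A) i)"
    by (simp add: sum_distrib_left poly_mod_sum coeff_sum mod_smult_left)
  finally show "mult_mat A (g * h) $$ (i, j) = (mult_mat A g * mult_mat A h) $$ (i, j)"
    using ij by (auto simp: mult_mat_def scalar_prod_def r_def lessThan_atLeast0 mult.commute)
qed auto

lemma mult_mat_eq_0: "A dvd g \<Longrightarrow> mult_mat A g = 0\<^sub>m (degree A) (degree A)"
  by (rule eq_matI) (auto simp: mult_mat_def)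

lemma det_mult_mat_power: "det (mult_mat A (g ^ n)) = det (mult_mat A g) ^ n"
  by (induction n) (simp_all add: mult_mat_one mult_mat_mult det_mult[of _ "degree A"])

text \<open>
  With \<open>N\<close> the matrix of \<open>g\<close>, the matrix of \<open>H \<circ> g\<close> is \<open>H(N)\<close>, and \<open>H(t) I - H(N)\<close> is divisible by
  \<open>t I - N\<close> for the reason that \<open>H(t) - H(u)\<close> is divisible by \<open>t - u\<close>.  The induction follows
  Horner's scheme, so \<open>H(N)\<close> never has to be written as a polynomial in a matrix.  The polynomial
  \<open>H\<close> itself plays the part of \<open>H(t)\<close>.
\<close>

lemma char_poly_matrix_dvd_diff:
  "\<exists>R \<in> carrier_mat (degree A) (degree A).
     H \<cdot>\<^sub>m 1\<^sub>m (degree A) - map_mat (\<lambda>a. [:a:]) (mult_mat A (H \<circ>\<^sub>p g)) =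
     char_poly_matrix (mult_mat A g) * R"
proof (induction H)
  case 0
  show ?case by (rule bexI[of _ "0\<^sub>m (degree A) (degree A)"]) (auto simp: mult_mat_eq_0 right_mult_zero_mat[of _ "degree A" "degree A"])
next
  case (pCons a H)
  define n where "n = degree A"
  define X :: "'a poly" where "X = [:0, 1:]"
  define N where "N = mult_mat A g"
  define M where "M = mult_mat A (H \<circ>\<^sub>p g)"
  let ?C = "map_mat (\<lambda>a. [:a:])"
  let ?N' = "map_mat (\<lambda>a. [:-a:]) N"
  have NM: "N \<in> carrier_mat n n" "M \<in> carrier_mat n n"
    by (simp_all add: N_def M_def n_def)
  have C': "?N' \<in> carrier_mat n n" "?C M \<in> carrier_mat n n" using NM by auto
  from pCons.IH obtain R where R: "R \<in> carrier_mat n n"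
    and IH: "H \<cdot>\<^sub>m 1\<^sub>m n - ?C M = char_poly_matrix N * R"
    by (auto simp: n_def N_def M_def)
  have cp: "char_poly_matrix N = X \<cdot>\<^sub>m 1\<^sub>m n + ?N'"
    using NM by (simp add: char_poly_matrix_def X_def)
  have comp: "mult_mat A (pCons a H \<circ>\<^sub>p g) = a \<cdot>\<^sub>m 1\<^sub>m n + N * M"
    by (simp add: pcompose_pCons mult_mat_add mult_mat_mult N_def M_def n_def mult_mat_const)
  have "?N' * ?C M = - ?C (N * M)"
  proof (rule eq_matI)
    fix i j assume "i < dim_row (- ?C (N * M))" "j < dim_col (- ?C (N * M))"
    hence ij: "i < n" "j < n" using NM by auto
    have "(\<Sum>k=0..<n. [:- (N $$ (i, k)):] * [:M $$ (k, j):]) = (\<Sum>k=0..<n. - [:N $$ (i, k) * M $$ (k, j):])"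
      by (intro sum.cong) auto
    also have "\<dots> = - [:\<Sum>k=0..<n. N $$ (i, k) * M $$ (k, j):]"
      by (simp only: sum_negf const_sum)
    finally show "(?N' * ?C M) $$ (i, j) = (- ?C (N * M)) $$ (i, j)"
      using NM ij by (simp add: scalar_prod_def)
  qed (use NM in auto)
  moreover have sm: "(X \<cdot>\<^sub>m 1\<^sub>m n) * ?C M = X \<cdot>\<^sub>m ?C M"
    by (subst mult_smult_assoc_mat[OF one_carrier_mat C'(2)]) (use C' in simp)
  ultimately have "char_poly_matrix N * ?C M = X \<cdot>\<^sub>m ?C M - ?C (N * M)"
    using NM C' by (simp add: cp add_mult_distrib_mat[of _ n n] minus_add_uminus_mat[of _ n n])
  moreover have cpc: "char_poly_matrix N \<in> carrier_mat n n" using NM by simp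
  ultimately have "char_poly_matrix N * (X \<cdot>\<^sub>m R + ?C M) = X \<cdot>\<^sub>m (H \<cdot>\<^sub>m 1\<^sub>m n - ?C M) + (X \<cdot>\<^sub>m ?C M - ?C (N * M))"
    using NM R C' by (simp add: IH mult_add_distrib_mat[OF cpc, of _ n] mult_smult_distrib[OF cpc, of _ n])
  also have "\<dots> = pCons a H \<cdot>\<^sub>m 1\<^sub>m n - ?C (a \<cdot>\<^sub>m 1\<^sub>m n + N * M)"
    using NM by (intro eq_matI) (auto simp: X_def algebra_simps)
  finally show ?case
    using R NM by (intro bexI[of _ "X \<cdot>\<^sub>m R + ?C M"]) (auto simp: comp n_def N_def M_def simp del: pcompose_pCons)
qed

text \<open>
  If \<open>A\<close> divides \<open>H \<circ> g\<close>, then \<open>H(N) = 0\<close>, and determinants of the preceding factorization give a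
  divisibility over the base field, without passing to eigenvalues.
\<close>

lemma char_poly_mult_mat_dvd:
  assumes "A dvd H \<circ>\<^sub>p g"
  shows "char_poly (mult_mat A g) dvd H ^ degree A"
proof -
  from char_poly_matrix_dvd_diff obtain R where R: "R \<in> carrier_mat (degree A) (degree A)"
    and "H \<cdot>\<^sub>m 1\<^sub>m (degree A) - map_mat (\<lambda>a. [:a:]) (mult_mat A (H \<circ>\<^sub>p g)) =
     char_poly_matrix (mult_mat A g) * R" by blast
  moreover have "H \<cdot>\<^sub>m 1\<^sub>m (degree A) - map_mat (\<lambda>a. [:a:]) (mult_mat A (H \<circ>\<^sub>p g)) = H \<cdot>\<^sub>m 1\<^sub>m (degree A)"
    using assms by (intro eq_matI) (auto simp: mult_mat_eq_0)
  ultimately have "det (H \<cdot>\<^sub>m 1\<^sub>m (degree A)) = char_poly (mult_mat A g) * det R"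
    by (simp add: char_poly_def det_mult[of _ "degree A"])
  thus ?thesis by simp
qed

lemma poly_char_poly_0: "poly (char_poly (mult_mat A g)) 0 = (-1) ^ degree A * det (mult_mat A g)"
proof -
  have "char_matrix (mult_mat A g) 0 = mult_mat A g"
    by (rule eq_matI) (auto simp: char_matrix_def)
  moreover have "- mult_mat A g = (-1) \<cdot>\<^sub>m mult_mat A g"
    by (rule eq_matI) auto
  ultimately show ?thesis
    by (simp add: char_poly_matrix[of _ "degree A"])
qed

lemma power_of_coprime_exponents:
  fixes h E :: "'a::field"
  assumes "coprime k p" "k > 0" "p > 0" "h ^ k = E ^ p"
  shows "\<exists>y. h = y ^ p"
proof (cases "h = 0")
  case True
  thus ?thesis using assms by (intro exI[of _ 0]) (simp add: zero_power)
next
  case False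
  obtain a b where ab: "a * k = b * p + 1"
    using bezout_nat[of k p] assms by (metis coprime_imp_gcd_eq_1 mult.commute not_gr_zero)
  have "(E ^ a) ^ p = (E ^ p) ^ a" by (simp add: mult.commute flip: power_mult)
  also have "\<dots> = h ^ (a * k)" by (simp add: assms(4)[symmetric] mult.commute flip: power_mult)
  also have "\<dots> = (h ^ b) ^ p * h" by (simp add: ab power_mult)
  finally have "(E ^ a) ^ p = (h ^ b) ^ p * h" .
  hence "h = (E ^ a / h ^ b) ^ p" using False by (simp add: power_divide)
  thus ?thesis ..
qed

lemma monic_dvd_irreducible_power:
  fixes H :: "'a::field poly"
  assumes irr: "irreducible H" and monic: "lead_coeff H = 1"
  shows "C dvd H ^ m \<Longrightarrow> lead_coeff C = 1 \<Longrightarrow> \<exists>k. C = H ^ k"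
proof (induction m arbitrary: C)
  case 0
  hence "degree C = 0" by (auto simp: poly_dvd_1)
  then obtain a where "C = [:a:]" by (rule degree_eq_zeroE)
  hence "C = 1" using 0 by (simp add: one_pCons)
  thus ?case by (intro exI[of _ 0]) simp
next
  case (Suc m)
  have H: "prime_elem H" "H \<noteq> 0"
    using irr field_poly_irreducible_imp_prime by auto
  obtain E where E: "H * H ^ m = C * E" using Suc.prems(1) unfolding dvd_def by auto
  show ?case
  proof (cases "H dvd C")
    case True
    then obtain B where B: "C = H * B" by blast
    hence "H ^ m = B * E" using E H by simp
    moreover have "lead_coeff B = 1" using B Suc.prems(2) monic by (simp add: lead_coeff_mult)
    ultimately obtain k where "B = H ^ k" using Suc.IH[of B] by auto
    thus ?thesis using B by (intro exI[of _ "Suc k"]) simp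
  next
    case False
    moreover have "H dvd C * E" by (metis E dvd_triv_left)
    ultimately obtain B where "E = H * B" using prime_elem_dvd_multD[OF H(1)] by blast
    hence "H ^ m = C * B" using E H by simp
    thus ?thesis using Suc by auto
  qed
qed

text \<open>
  Let \<open>A\<close> be a proper factor of \<open>H(x\<^sup>p)\<close>.  The characteristic polynomial of multiplication by
  \<open>x\<^sup>p\<close> modulo \<open>A\<close> divides a power of \<open>H\<close>, so it equals \<open>H\<^sup>k\<close>, where \<open>degree A = k * degree H\<close> forces
  \<open>0 < k < p\<close>.  Its constant term is, up to sign, the determinant of a \<open>p\<close>-th power, so \<open>H(0)\<^sup>k\<close> is a
  \<open>p\<close>-th power up to sign, and \<open>k\<close> is coprime to \<open>p\<close>.  The sign is absorbed if \<open>p\<close> is odd; for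
  \<open>p = 2\<close> it is positive because \<open>degree H\<close> is even.
\<close>

lemma reducible_subst_power:
  fixes H :: "'a::field poly"
  assumes irr: "irreducible H" and monic: "lead_coeff H = 1"
    and p: "prime p" and ev: "p = 2 \<Longrightarrow> even (degree H)"
    and red: "\<not> irreducible (H \<circ>\<^sub>p monom 1 p)"
  shows "\<exists>y. poly H 0 = y ^ p"
proof -
  have H0: "degree H > 0" "H \<noteq> 0" using irr
    by (metis irreducible_def is_unit_iff_degree bot_nat_0.not_eq_extremum) (use irr in auto)
  have p0: "p > 0" using p prime_gt_0_nat by blast
  have deg: "degree (H \<circ>\<^sub>p monom 1 p) = degree H * p"
    by (simp add: degree_pcompose degree_monom_eq)
  hence nz: "H \<circ>\<^sub>p monom 1 p \<noteq> 0" "\<not> H \<circ>\<^sub>p monom 1 p dvd 1"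
    using H0 p0 by (metis degree_0 mult_eq_0_iff neq0_conv, metis is_unit_iff_degree degree_0 mult_eq_0_iff neq0_conv)
  with red obtain A B where AB: "H \<circ>\<^sub>p monom 1 p = A * B" "\<not> A dvd 1" "\<not> B dvd 1"
    by (auto simp: irreducible_def)
  hence "A \<noteq> 0" "B \<noteq> 0" using nz by auto
  hence degA: "degree A > 0" and degA': "degree A < degree H * p"
    using AB deg by (auto simp: is_unit_iff_degree degree_mult_eq)
  define g where "g = monom (1::'a) p"
  define C where "C = char_poly (mult_mat A g)"
  have C: "degree C = degree A" "lead_coeff C = 1"
    using degree_monic_char_poly[OF mult_mat_carrier[of A g]] by (auto simp: C_def)
  have "C dvd H ^ degree A" unfolding C_def by (rule char_poly_mult_mat_dvd) (simp add: g_def AB)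
  then obtain k where Ck: "C = H ^ k"
    using monic_dvd_irreducible_power[OF irr monic] C(2) by blast
  have dk: "degree A = degree H * k"
    using C(1) Ck monic H0 by (simp add: degree_power_eq mult.commute)
  have k: "0 < k" "k < p" using dk degA degA' by auto
  \<comment> \<open>Modulo \<open>A\<close>, multiplication by \<open>g = x\<^sup>p\<close> is the \<open>p\<close>-th power of multiplication by \<open>x\<close>.\<close>
  define D where "D = det (mult_mat A [:0, 1:])"
  have "g = [:0, 1:] ^ p" by (simp add: g_def monom_altdef)
  hence eq: "poly H 0 ^ k = (-1) ^ degree A * D ^ p"
    using poly_char_poly_0[of A g] Ck by (simp add: C_def D_def det_mult_mat_power poly_power)
  have "\<exists>E. poly H 0 ^ k = E ^ p"
  proof (cases "p = 2")
    case True
    thus ?thesis using eq ev dk by auto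
  next
    case False
    hence "odd p" using p by (metis primes_dvd_imp_eq two_is_prime_nat)
    hence "(-1) ^ degree A * D ^ p = ((-1) ^ degree A * D) ^ p"
      by (simp add: power_mult_distrib minus_one_power_iff)
    thus ?thesis using eq by metis
  qed
  moreover have "coprime k p"
    using k p by (metis coprime_commute nat_dvd_not_less prime_imp_coprime)
  ultimately show ?thesis using power_of_coprime_exponents k p0 by blast
qed

lemma monom_pcompose: "monom 1 n \<circ>\<^sub>p q = q ^ n"
  by (induction n) (simp_all add: monom_0 monom_Suc pcompose_pCons one_pCons)

lemma irreducible_pcomposeD:
  fixes f g :: "'a::field poly"
  assumes irr: "irreducible (f \<circ>\<^sub>p g)" and g: "degree g > 0"
  shows "irreducible f"
proof (rule irreducibleI)
  show f0: "f \<noteq> 0" using irr by auto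
  show "\<not> f dvd 1"
  proof
    assume "f dvd 1"
    then obtain h where "1 = f * h" by (auto simp: dvd_def)
    hence "1 = (f \<circ>\<^sub>p g) * (h \<circ>\<^sub>p g)" by (metis pcompose_1 pcompose_mult)
    hence "f \<circ>\<^sub>p g dvd 1" by (metis dvd_triv_left)
    thus False using irr by (simp add: irreducible_def)
  qed
  fix a b assume f: "f = a * b"
  hence ab: "a \<noteq> 0" "b \<noteq> 0" using f0 by auto
  have "h dvd 1" if "h \<circ>\<^sub>p g dvd 1" "h \<noteq> 0" for h
  proof -
    have "degree (h \<circ>\<^sub>p g) = 0" using that(1) by (auto simp: poly_dvd_1)
    hence "degree h = 0" using g by (simp add: degree_pcompose)
    thus ?thesis using that(2) by (simp add: is_unit_iff_degree)
  qed
  moreover have "a \<circ>\<^sub>p g dvd 1 \<or> b \<circ>\<^sub>p g dvd 1"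
    by (rule irreducibleD[OF irr]) (simp add: f pcompose_mult)
  ultimately show "a dvd 1 \<or> b dvd 1" using ab by blast
qed

text \<open>
  The prime factors of \<open>d\<close> are substituted one at a time, and no substitution changes the constant
  term \<open>H(0)\<close>.  The exceptional form \<open>- 4 * b\<^sup>4\<close> in Capelli's theorem for \<open>4\<close> dividing \<open>d\<close> leaves no
  trace here, because its norm from an extension of even degree is a square.
\<close>

lemma reducible_subst_monom:
  fixes H :: "'a::field poly"
  assumes "irreducible H" "lead_coeff H = 1" "d > 0" "even d \<Longrightarrow> even (degree H)"
    and "\<not> irreducible (H \<circ>\<^sub>p monom 1 d)"
  shows "\<exists>p y. prime p \<and> p dvd d \<and> poly H 0 = y ^ p"
  using assms
proof (induction d arbitrary: H rule: less_induct)
  case (less d)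
  show ?case
  proof (cases "d = 1")
    case True
    hence "H \<circ>\<^sub>p monom 1 d = H" by (simp add: monom_altdef)
    thus ?thesis using less.prems by simp
  next
    case False
    then obtain p where p: "prime p" "p dvd d" using prime_factor_nat by blast
    then obtain e where d: "d = p * e" by blast
    have p2: "p \<ge> 2" using p prime_ge_2_nat by blast
    show ?thesis
    proof (cases "irreducible (H \<circ>\<^sub>p monom 1 p)")
      case False
      have "even (degree H)" if "p = 2" using less.prems(4) that p by simp
      thus ?thesis using reducible_subst_power[OF less.prems(1,2) p(1) _ False] p by blast
    next
      case True
      have e: "0 < e" using d less.prems(3) by (cases "e = 0") auto
      hence "1 * e < p * e" using p2 by (intro mult_strict_right_mono) auto
      hence ed: "e < d" using d by simp
      have "H \<circ>\<^sub>p monom 1 p \<circ>\<^sub>p monom 1 e = H \<circ>\<^sub>p monom 1 d"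
        by (simp add: d monom_pcompose monom_power mult.commute flip: pcompose_assoc)
      moreover have "lead_coeff (H \<circ>\<^sub>p monom 1 p) = 1"
        using less.prems(2) p2 by (subst lead_coeff_comp) (auto simp: degree_monom_eq)
      moreover have "even (degree (H \<circ>\<^sub>p monom 1 p))" if "even e"
        using that less.prems(4) d by (simp add: degree_pcompose)
      ultimately have "\<exists>q y. prime q \<and> q dvd e \<and> poly (H \<circ>\<^sub>p monom 1 p) 0 = y ^ q"
        using less.IH[OF ed True] e less.prems(5) by simp
      thus ?thesis using d p2 by (auto simp: poly_pcompose poly_monom power_0_left)
    qed
  qed
qed

lemma degree_unicritical: "d > 0 \<Longrightarrow> degree (unicritical d c) = d"
  by (simp add: unicritical_def degree_add_eq_left degree_monom_eq)

lemma lead_coeff_unicritical: "d > 0 \<Longrightarrow> lead_coeff (unicritical d c) = 1"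
  by (simp add: degree_unicritical) (simp add: unicritical_def coeff_pCons split: nat.split)

lemma poly_unicritical: "poly (unicritical d c) x = x ^ d + c"
  by (simp add: unicritical_def poly_monom)

text \<open>
  Translating by \<open>c\<close> preserves irreducibility and turns the constant term into the value \<open>F(c)\<close>.
\<close>

lemma reducible_pcompose_unicritical:
  assumes irr: "irreducible F" and "lead_coeff F = 1" "d > 0" "even d \<Longrightarrow> even (degree F)"
    and red: "\<not> irreducible (F \<circ>\<^sub>p unicritical d c)"
  shows "\<exists>p y. prime p \<and> p dvd d \<and> poly F c = y ^ p"
proof -
  define H where "H = F \<circ>\<^sub>p [:c, 1:]"
  have "H \<circ>\<^sub>p [:-c, 1:] = F"
    by (simp add: H_def pcompose_pCons flip: pcompose_assoc)
  hence "irreducible H" using irr irreducible_pcomposeD[of H "[:-c, 1:]"] by simp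
  moreover have "H \<circ>\<^sub>p monom 1 d = F \<circ>\<^sub>p unicritical d c"
    by (simp add: H_def unicritical_def pcompose_pCons add.commute flip: pcompose_assoc)
  moreover have "lead_coeff H = 1" using assms(2) lead_coeff_comp[of "[:c, 1:]" F] by (simp add: H_def)
  moreover have "degree H = degree F" by (simp add: H_def degree_pcompose)
  ultimately show ?thesis using reducible_subst_monom[of H d] assms by (simp add: H_def poly_pcompose)
qed

section \<open>Gaps between perfect powers and integer orbits\<close>

lemma rat_power_of_int_is_int:
  fixes y :: rat
  assumes "y ^ p = of_int m" "p > 0"
  shows "\<exists>z. y = of_int z"
proof -
  obtain a b where ab: "quotient_of y = (a, b)" by force
  hence cop: "coprime a b" and b: "b > 0" and y: "y = of_int a / of_int b"
    by (auto simp: quotient_of_coprime quotient_of_denom_pos quotient_of_div)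
  have "of_int (a ^ p) = (of_int (m * b ^ p) :: rat)"
    using assms b by (simp add: y power_divide field_simps)
  hence "a ^ p = m * b ^ p" by (simp only: of_int_eq_iff)
  hence "b ^ p dvd a ^ p" by simp
  hence "b dvd a" using \<open>p > 0\<close> by simp
  hence "b = 1" using cop b by (metis coprime_common_divisor dvd_refl int_one_le_iff_zero_less zdvd1_eq abs_of_pos)
  thus ?thesis using y by auto
qed

text \<open>
  The \<open>k\<close>-th power nearest to \<open>u\<^sup>k\<close> is \<open>(u - 1)\<^sup>k\<close>, and the bound consists of the two leading terms
  of \<open>u\<^sup>k - (u - 1)\<^sup>k\<close>, factored as a sum of \<open>k\<close> products of powers.  Two terms are kept because \<open>u\<^bsup>k-1\<^esup>\<close>
  alone would be too weak in the applications.
\<close>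

lemma power_gap_nonneg:
  fixes u v :: int
  assumes "0 \<le> v" "0 < u" "v \<noteq> u" "k \<ge> 2"
  shows "\<bar>v ^ k - u ^ k\<bar> \<ge> u ^ (k - 1) + (u - 1) * u ^ (k - 2)"
proof -
  obtain j where k: "k = Suc (Suc j)" using assms(4) by (metis Suc_1 add_2_eq_Suc le_Suc_ex)
  define P where "P = u ^ j"
  have P: "P \<ge> 0" using assms by (simp add: P_def)
  have rhs: "u ^ (k - 1) + (u - 1) * u ^ (k - 2) = 2 * (u * P) - P"
    by (simp add: k P_def algebra_simps)
  have uk: "u ^ k = u * u * P" by (simp add: k P_def)
  show ?thesis
  proof (cases "v > u")
    case True
    hence "(u + 1) * (u + 1) * P \<le> v * v * v ^ j"
      unfolding P_def using assms by (intro mult_mono power_mono) auto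
    hence "v ^ k \<ge> u * u * P + 2 * (u * P) + P" by (simp add: k algebra_simps)
    thus ?thesis using P unfolding rhs uk by linarith
  next
    case False
    hence "v * v * v ^ j \<le> (u - 1) * (u - 1) * P"
      unfolding P_def using assms by (intro mult_mono power_mono) auto
    hence "v ^ k \<le> u * u * P - 2 * (u * P) + P" by (simp add: k algebra_simps)
    thus ?thesis unfolding rhs uk by linarith
  qed
qed

lemma power_gap:
  fixes s t :: int
  assumes "s ^ k \<noteq> t ^ k" "t \<noteq> 0" "k \<ge> 2"
  shows "\<bar>s ^ k - t ^ k\<bar> \<ge> \<bar>t\<bar> ^ (k - 1) + (\<bar>t\<bar> - 1) * \<bar>t\<bar> ^ (k - 2)"
proof (cases "\<bar>s\<bar> = \<bar>t\<bar>")
  case False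
  have "\<bar>t\<bar> ^ (k - 1) + (\<bar>t\<bar> - 1) * \<bar>t\<bar> ^ (k - 2) \<le> \<bar>\<bar>s\<bar> ^ k - \<bar>t\<bar> ^ k\<bar>"
    using assms False by (intro power_gap_nonneg) auto
  also have "\<dots> \<le> \<bar>s ^ k - t ^ k\<bar>"
    by (metis abs_triangle_ineq3 power_abs)
  finally show ?thesis .
next
  case True
  hence s: "s ^ k = - (t ^ k)" using assms by (metis abs_eq_iff power_minus_even power_minus_odd)
  obtain j where k: "k = Suc (Suc j)" using assms(3) by (metis Suc_1 add_2_eq_Suc le_Suc_ex)
  define w P where "w = \<bar>t\<bar>" and "P = w ^ j"
  have "0 \<le> P * ((w - 1) * (w - 1) + w * w)" by (simp add: w_def P_def)
  moreover have "\<bar>s ^ k - t ^ k\<bar> = 2 * w ^ k" by (simp add: s abs_mult power_abs w_def)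
  ultimately show ?thesis by (simp add: k algebra_simps P_def flip: w_def)
qed

text \<open>
  Here the number \<open>y\<^sup>p\<close> lies at distance \<open>\<bar>c\<bar>\<close> from the \<open>p\<close>-th power \<open>c\<^sup>d\<close>, whose distance to
  other \<open>p\<close>-th powers exceeds \<open>\<bar>c\<bar>\<close> unless \<open>\<bar>c\<bar> = 1\<close>; and \<open>2\<close> is no perfect power.
\<close>

lemma critical_orbit_2:
  fixes c y :: int
  assumes "d \<ge> 2" "p dvd d" "prime p" "c \<noteq> 0" "c \<noteq> -1"
  shows "y ^ p \<noteq> c ^ d + c"
proof
  assume eq: "y ^ p = c ^ d + c"
  obtain e where d: "d = e * p" using assms(2) by (metis dvd_def mult.commute)
  have p: "p \<ge> 2" using assms(3) by (rule prime_ge_2_nat)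
  have e: "e \<ge> 1" using d assms(1) by (cases e) auto
  define u where "u = \<bar>c ^ e\<bar>"
  have u: "\<bar>c\<bar> \<le> u" using e assms(4) by (simp add: u_def power_abs self_le_power)
  have ne: "y ^ p \<noteq> (c ^ e) ^ p" using eq assms(4) by (simp add: d power_mult)
  have "u ^ (p - 1) + (u - 1) * u ^ (p - 2) \<le> \<bar>y ^ p - (c ^ e) ^ p\<bar>"
    unfolding u_def using ne assms(4) p by (intro power_gap) auto
  hence le: "u ^ (p - 1) + (u - 1) * u ^ (p - 2) \<le> \<bar>c\<bar>"
    by (simp add: eq d power_mult)
  have "u \<le> u ^ (p - 1)" "1 \<le> u ^ (p - 2)" using u assms(4) p by (auto intro!: self_le_power one_le_power)
  moreover from this u assms(4) have "(u - 1) * 1 \<le> (u - 1) * u ^ (p - 2)" by (intro mult_left_mono) auto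
  ultimately have "u + (u - 1) \<le> u ^ (p - 1) + (u - 1) * u ^ (p - 2)"
    by (intro add_mono) simp_all
  hence "2 * u - 1 \<le> \<bar>c\<bar>" using le by simp
  hence "\<bar>c\<bar> = 1" using u assms(4) by linarith
  hence "c = 1" using assms(5) by linarith
  hence "y ^ p = 2" using eq by simp
  hence "\<bar>y\<bar> ^ p = 2" by (metis abs_numeral power_abs)
  moreover have "\<bar>y\<bar> ^ 2 \<le> \<bar>y\<bar> ^ p" if "\<bar>y\<bar> \<ge> 2" using p that by (intro power_increasing) auto
  moreover have "\<bar>y\<bar> ^ 2 \<ge> 2 ^ 2" if "\<bar>y\<bar> \<ge> 2" using that by (intro power_mono) auto
  moreover have "\<bar>y\<bar> ^ p \<le> 1" if "\<bar>y\<bar> < 2" using that by (intro power_le_one) auto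
  ultimately show False by (cases "\<bar>y\<bar> \<ge> 2") auto
qed

text \<open>
  The gap between \<open>y\<^sup>p\<close> and \<open>X\<^sup>d\<close> is at least \<open>\<bar>X\<bar>\<close> raised to \<open>d - d / p\<close>, and this exponent is at
  least \<open>2\<close> for \<open>d \<ge> 3\<close>.
\<close>

lemma small_of_power:
  fixes X c y :: int
  assumes "d \<ge> 3" "p dvd d" "prime p" "c \<noteq> 0" "X \<noteq> 0" and eq: "y ^ p = X ^ d + c"
  shows "X\<^sup>2 \<le> \<bar>c\<bar>"
proof -
  obtain e where d: "d = e * p" using assms(2) by (metis dvd_def mult.commute)
  have p: "p \<ge> 2" using assms(3) by (rule prime_ge_2_nat)
  have e: "e \<ge> 1" using d assms(1) by (cases e) auto
  define u where "u = \<bar>X ^ e\<bar>"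
  have u: "u \<ge> 1" using assms(5) by (simp add: u_def power_abs)
  have ne: "y ^ p \<noteq> (X ^ e) ^ p" using eq assms(4) by (simp add: d power_mult)
  have "u ^ (p - 1) + (u - 1) * u ^ (p - 2) \<le> \<bar>y ^ p - (X ^ e) ^ p\<bar>"
    unfolding u_def using ne assms(5) p by (intro power_gap) auto
  hence "u ^ (p - 1) + (u - 1) * u ^ (p - 2) \<le> \<bar>c\<bar>"
    by (simp add: eq d power_mult)
  moreover have "(u - 1) * u ^ (p - 2) \<ge> 0" using u by simp
  ultimately have "u ^ (p - 1) \<le> \<bar>c\<bar>" by linarith
  moreover have "u ^ (p - 1) = \<bar>X\<bar> ^ (e * (p - 1))" by (simp add: u_def power_abs power_mult)
  moreover have "e * (p - 1) \<ge> 2"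
  proof (cases "e = 1")
    case True thus ?thesis using d assms(1) by simp
  next
    case False
    hence "2 * 1 \<le> e * (p - 1)" using e p by (intro mult_le_mono) auto
    thus ?thesis by simp
  qed
  hence "\<bar>X\<bar> ^ 2 \<le> \<bar>X\<bar> ^ (e * (p - 1))" using assms(5) by (intro power_increasing) auto
  ultimately show ?thesis by simp
qed

text \<open>
  Otherwise \<open>\<bar>W - X\<bar>\<close> is the distance of distinct \<open>d\<close>-th powers, so it is at least about
  \<open>\<bar>W\<bar>\<^bsup>d-1\<^esup>\<close>, and then \<open>X\<close> is at least that large.  But \<open>X\<^sup>2 \<le> \<bar>c\<bar>\<close>, and \<open>c\<close> has about the
  size of \<open>W\<^sup>d\<close>, which contradicts \<open>2 * (d - 1) > d\<close>.  Only \<open>\<bar>W\<bar> = 1\<close> escapes the estimate.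
\<close>

lemma third_iterate_power:
  fixes a c y W X :: int
  assumes d: "d \<ge> 3" and p: "p dvd d" "prime p" and noroot: "\<And>z. z ^ d + c \<noteq> 0"
    and W: "W = a ^ d + c" and X: "X = W ^ d + c" and eq: "y ^ p = X ^ d + c"
  shows "W = X"
proof (rule ccontr)
  assume "W \<noteq> X"
  have c: "c \<noteq> 0" using noroot[of 0] d by (auto simp: power_0_left)
  have W0: "W \<noteq> 0" and X0: "X \<noteq> 0" using noroot W X by auto
  define w x where "w = \<bar>W\<bar>" and "x = \<bar>X\<bar>"
  have w: "w \<ge> 1" and x: "x \<ge> 1" using W0 X0 by (auto simp: w_def x_def)
  have diff: "a ^ d - W ^ d = W - X" using W X by simp
  have "x\<^sup>2 \<le> \<bar>c\<bar>" using small_of_power[OF d p c X0 eq] by (simp add: x_def)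
  moreover have "\<bar>W ^ d\<bar> = w ^ d" by (simp add: w_def power_abs)
  hence "\<bar>c\<bar> \<le> w ^ d + x" using X by (auto simp: x_def)
  ultimately have xw: "x\<^sup>2 \<le> w ^ d + x" by linarith
  define j where "j = d - 3"
  have j: "d = Suc (Suc (Suc j))" using d by (simp add: j_def)
  show False
  proof (cases "w = 1")
    case True
    have "x \<le> 1"
    proof (rule ccontr)
      assume "\<not> x \<le> 1"
      hence "2 * x \<le> x * x" by (intro mult_right_mono) auto
      with xw True \<open>\<not> x \<le> 1\<close> show False by (simp add: power2_eq_square)
    qed
    hence "x = 1" using x by simp
    \<comment> \<open>Now \<open>a\<^sup>d = W\<^sup>d + 2 * W\<close> is \<open>3\<close>, \<open>-3\<close>, or the negative number \<open>-1\<close> with \<open>d\<close> even.\<close>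
    hence WX: "X = - W" using \<open>W \<noteq> X\<close> True by (auto simp: w_def x_def)
    hence ad: "a ^ d = W ^ d + 2 * W" using diff by simp
    have W1: "W = 1 \<or> W = -1" using True by (auto simp: w_def)
    have ab: "\<bar>a\<bar> ^ d = 3 \<or> a ^ d = -1 \<and> even d"
      using W1 by (cases "even d") (auto simp: ad simp flip: power_abs)
    moreover have "\<not> (a ^ d = -1 \<and> even d)" by (metis zero_le_even_power not_one_le_zero neg_0_le_iff_le)
    ultimately have a3: "\<bar>a\<bar> ^ d = 3" by blast
    show False
    proof (cases "\<bar>a\<bar> \<ge> 2")
      case True
      have "(2::int) ^ 3 \<le> 2 ^ d" using d by (intro power_increasing) auto
      also have "\<dots> \<le> \<bar>a\<bar> ^ d" using True by (intro power_mono) auto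
      finally show False using a3 by simp
    next
      case False
      hence "\<bar>a\<bar> ^ d \<le> 1" by (intro power_le_one) auto
      thus False using a3 by simp
    qed
  next
    case False
    hence w2: "w \<ge> 2" using w by simp
    have "w ^ (d - 1) + (w - 1) * w ^ (d - 2) \<le> \<bar>W - X\<bar>"
      unfolding w_def diff[symmetric] using diff \<open>W \<noteq> X\<close> W0 d by (intro power_gap) auto
    also have "\<dots> \<le> w + x" by (auto simp: w_def x_def)
    finally have le: "w ^ (d - 1) + (w - 1) * w ^ (d - 2) \<le> w + x" .
    define P where "P = w * w ^ j"
    have P: "w \<le> P" using w by (simp add: P_def)
    have pw: "w ^ d = w * w * P" "w ^ (d - 1) = w * P" "w ^ (d - 2) = P" by (simp_all add: j P_def)
    have "1 * P \<le> (w - 1) * P" using w2 P by (intro mult_right_mono) auto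
    hence xP: "w * P \<le> x" using le P unfolding pw by linarith
    have wP: "2 * P \<le> w * P" using w2 P by (intro mult_right_mono) auto
    \<comment> \<open>Since \<open>w * P\<close> is \<open>w\<close> to the power \<open>d - 1\<close>, this compares \<open>x\<^sup>2\<close> with \<open>w\<close> to the power \<open>d\<close>.\<close>
    have "w * P * (w * P - 1) \<le> x * (x - 1)" using xP wP P w x by (intro mult_mono) auto
    also have "\<dots> \<le> w * w * P" using xw by (simp add: pw power2_eq_square algebra_simps)
    finally have "w * P * (w * P - 1) \<le> w * P * w" by (simp add: mult_ac)
    hence "w * P - 1 \<le> w" using w P by (subst (asm) mult_le_cancel_left_pos) auto
    thus False using wP P w2 by linarith
  qed
qed

lemma square_gap:
  fixes X c y :: int
  assumes "y\<^sup>2 = X\<^sup>2 + c" "c \<noteq> 0" "X \<noteq> 0"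
  shows "2 * \<bar>X\<bar> - 1 \<le> \<bar>c\<bar>"
  using power_gap[of y 2 X] assms by simp

text \<open>
  The base \<open>c\<^sup>2 + c = c * (c + 1)\<close> is so large that no other square lies within \<open>\<bar>c\<bar>\<close> of its square.
\<close>

lemma critical_orbit_3_square:
  fixes c y :: int
  assumes "c \<noteq> 0" "c \<noteq> -1"
  shows "y\<^sup>2 \<noteq> (c\<^sup>2 + c)\<^sup>2 + c"
proof
  assume eq: "y\<^sup>2 = (c\<^sup>2 + c)\<^sup>2 + c"
  have c2: "c\<^sup>2 + c = c * (c + 1)" by (simp add: power2_eq_square algebra_simps)
  have le: "2 * \<bar>c\<^sup>2 + c\<bar> - 1 \<le> \<bar>c\<bar>"
    using eq assms by (intro square_gap) (auto simp: c2)
  show False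
  proof (cases "c > 0")
    case True
    hence "1 * c \<le> c * c" by (intro mult_right_mono) auto
    hence "c \<le> c\<^sup>2" by (simp add: power2_eq_square)
    hence "\<bar>c\<^sup>2 + c\<bar> \<ge> 2 * c" by simp
    thus ?thesis using le True by simp
  next
    case False
    hence "c \<le> -2" using assms by simp
    hence "2 * (-c) \<le> (-c) * (-c)" by (intro mult_right_mono) auto
    hence "- 2 * c \<le> c\<^sup>2" by (simp add: power2_eq_square)
    hence "\<bar>c\<^sup>2 + c\<bar> \<ge> - c" by simp
    thus ?thesis using le \<open>c \<le> -2\<close> by simp
  qed
qed

text \<open>
  The gap bound forces \<open>c < 0\<close>; with \<open>n = - c\<close>, the numbers \<open>\<bar>a\<bar>\<close>, \<open>\<bar>Z\<bar>\<close>, \<open>\<bar>W\<bar>\<close> are at most of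
  the order of \<open>\<surd>n\<close>.  As \<open>a\<^sup>2 - Z\<^sup>2 = Z - W\<close> is of that order as well, \<open>\<bar>a\<bar>\<close> and \<open>\<bar>Z\<bar>\<close> differ by at most \<open>1\<close>.
  Equality gives \<open>Z = W\<close> and hence \<open>W = X\<close>.  If they differ by \<open>1\<close>, then either \<open>\<bar>W\<bar> = \<bar>a\<bar>\<close>, which
  gives \<open>X = Z\<close>, or \<open>\<bar>W\<bar>\<close> is about \<open>3 * \<bar>Z\<bar>\<close>, which is too large.
\<close>

lemma fourth_iterate_square:
  fixes a c y Z W X :: int
  assumes noroot: "\<And>z. z\<^sup>2 + c \<noteq> 0"
    and Z: "Z = a\<^sup>2 + c" and W: "W = Z\<^sup>2 + c" and X: "X = W\<^sup>2 + c" and eq: "y\<^sup>2 = X\<^sup>2 + c"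
  shows "W = X \<or> Z = X"
proof (rule ccontr)
  assume "\<not> (W = X \<or> Z = X)"
  hence ne: "W \<noteq> X" "Z \<noteq> X" by auto
  have c: "c \<noteq> 0" "c \<noteq> -1" using noroot[of 0] noroot[of 1] by auto
  have X0: "X \<noteq> 0" using noroot X by auto
  have le: "2 * \<bar>X\<bar> - 1 \<le> \<bar>c\<bar>" by (rule square_gap[OF eq c(1) X0])
  have "c < 0"
  proof (rule ccontr)
    assume "\<not> c < 0"
    hence "c \<ge> 1" using c by simp
    moreover have "Z\<^sup>2 \<ge> 0" "W\<^sup>2 \<ge> 0" by simp_all
    ultimately have "W \<ge> 1" "X \<ge> c" "X \<ge> 1" using W X by linarith+
    hence "c = 1" "X = 1" using le \<open>c \<ge> 1\<close> by linarith+
    thus False using X \<open>W \<ge> 1\<close> by simp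
  qed
  define n where "n = - c"
  have n: "n \<ge> 2" using c \<open>c < 0\<close> by (simp add: n_def)
  have eqs: "a\<^sup>2 = n + Z" "Z\<^sup>2 = n + W" "W\<^sup>2 = n + X" using Z W X by (simp_all add: n_def)
  have Xn: "2 * X \<le> n + 1" using le \<open>c < 0\<close> by (simp add: n_def)
  define p q w where "p = \<bar>a\<bar>" and "q = \<bar>Z\<bar>" and "w = \<bar>W\<bar>"
  have nonneg: "p \<ge> 0" "q \<ge> 0" "w \<ge> 0" by (simp_all add: p_def q_def w_def)
  have sq: "p * p = n + Z" "q * q = n + W" "w * w = n + X"
    using eqs by (simp_all add: p_def q_def w_def power2_eq_square)
  have w2: "2 * (w * w) \<le> 3 * n + 1" using sq Xn by simp
  have pq: "p \<noteq> q" using sq ne W X by auto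
  have wp: "w \<noteq> p" using sq ne by auto
  have diff: "(p - q) * (p + q) = Z - W" using sq by (simp add: algebra_simps)
  \<comment> \<open>A large \<open>\<bar>W\<bar>\<close> contradicts \<open>2 * W\<^sup>2 \<le> 3 * n + 1\<close>: the sizes of \<open>a\<close> and \<open>Z\<close> leave
    only \<open>n \<le> 3\<close>.\<close>
  have far: False if "2 * p + q \<le> w"
  proof -
    have "(2 * p + q) * (2 * p + q) \<le> w * w" using that nonneg by (intro mult_mono) auto
    moreover have "p * q \<ge> 0" using nonneg by simp
    ultimately have "4 * (p * p) + q * q \<le> w * w" by (simp add: algebra_simps)
    moreover have "p * p \<ge> n - q" "q * q \<ge> n - w" using sq by (auto simp: q_def w_def)
    moreover have "q \<le> w" using that nonneg by linarith
    ultimately have "5 * n - 5 * w \<le> w * w" by linarith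
    hence nw: "7 * n - 1 \<le> 10 * w" using w2 by linarith
    hence "(7 * n - 1) * (7 * n - 1) \<le> (10 * w) * (10 * w)" using n by (intro mult_mono) auto
    hence "49 * (n * n) \<le> 164 * n + 49" using w2 by (simp add: algebra_simps)
    have "n \<le> 3"
    proof (rule ccontr)
      assume "\<not> n \<le> 3"
      hence "4 * n \<le> n * n" by (intro mult_right_mono) auto
      thus False using \<open>49 * (n * n) \<le> 164 * n + 49\<close> n \<open>\<not> n \<le> 3\<close> by linarith
    qed
    have "w < 3"
    proof (rule ccontr)
      assume "\<not> w < 3"
      hence "3 * 3 \<le> w * w" by (intro mult_mono) auto
      thus False using w2 \<open>n \<le> 3\<close> by simp
    qed
    hence "n = 2 \<or> n = 3" "w = 2" using nw n \<open>n \<le> 3\<close> by auto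
    hence n3: "n = 3" "w = 2" using w2 by auto
    hence "(p = 0 \<or> p = 1) \<and> (q = 0 \<or> q = 1 \<or> q = 2)" using that nonneg by auto
    thus False using n3 that sq by (auto simp: q_def w_def abs_if split: if_splits)
  qed
  consider "p \<ge> q + 2" | "p = q + 1" | "p = q - 1" | "p \<le> q - 2" using pq by linarith
  thus False
  proof cases
    case 1
    hence "2 * (p + q) \<le> (p - q) * (p + q)" using nonneg by (intro mult_right_mono) auto
    hence "2 * p + q \<le> w" unfolding diff by (auto simp: q_def w_def)
    thus False by (rule far)
  next
    \<comment> \<open>The sign of \<open>Z\<close> decides between \<open>\<bar>W\<bar> = \<bar>a\<bar>\<close> and \<open>\<bar>W\<bar> = 3 * \<bar>Z\<bar> + 1\<close>.\<close>
    case 2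
    hence ZW: "Z - W = 2 * q + 1" using diff by simp
    have "Z < 0" using ZW wp 2 nonneg by (auto simp: q_def w_def)
    hence W3: "W = - (3 * q + 1)" using ZW by (simp add: q_def)
    hence "w = 3 * q + 1" using nonneg by (simp add: w_def)
    hence "15 * (q * q) + 3 * q \<le> 2" using w2 sq(2) W3 by (simp add: algebra_simps)
    moreover have "q * q \<ge> 0" by simp
    ultimately have "q = 0" using nonneg(2) by linarith
    thus False using sq(2) W3 n by simp
  next
    \<comment> \<open>As before, now with \<open>\<bar>W\<bar> = \<bar>a\<bar>\<close> or \<open>\<bar>W\<bar> = 3 * \<bar>Z\<bar> - 1\<close>.\<close>
    case 3
    hence WZ: "W - Z = 2 * q - 1" using diff by simp
    have "Z > 0" using WZ wp 3 nonneg by (auto simp: q_def w_def)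
    hence W3: "W = 3 * q - 1" using WZ by (simp add: q_def)
    hence w3: "w = 3 * q - 1" using 3 nonneg by (simp add: w_def)
    have "w * w = 9 * (q * q) - 6 * q + 1" unfolding w3 by (simp add: algebra_simps)
    hence "15 * (q * q) \<le> 3 * q + 2" using w2 sq(2) W3 by linarith
    moreover have "1 * q \<le> q * q" using 3 nonneg by (intro mult_right_mono) auto
    ultimately show False using 3 nonneg by simp
  next
    case 4
    hence "2 * (p + q) \<le> (q - p) * (p + q)" using nonneg by (intro mult_right_mono) auto
    also have "\<dots> = W - Z" using diff by (simp add: algebra_simps)
    finally have "2 * p + q \<le> w" by (auto simp: q_def w_def)
    thus False by (rule far)
  qed
qed

section \<open>Irreducibility along the semigroup\<close>

lemma irreducible_generator:
  assumes "h \<in> comp_semigroup S" "irreducible h" "\<And>f. f \<in> S \<Longrightarrow> degree f > 0"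
  shows "\<exists>f\<in>S. irreducible f"
  using assms(1,2)
proof (induction h rule: comp_semigroup.induct)
  case (comp f g)
  have "degree g > 0" using comp.hyps(2)
    by induction (use assms(3) in \<open>auto simp: degree_pcompose\<close>)
  thus ?case using comp irreducible_pcomposeD by blast
qed auto

text \<open>
  The invariant carried along the semigroup.  Divisibility of the degree by \<open>d\<close> supplies the even
  degree that the irreducibility criterion needs for even \<open>d\<close>; the powers are taken in \<open>\<rat>\<close> because
  the criterion produces rational ones.
\<close>

definition power_avoiding :: "nat \<Rightarrow> rat poly \<Rightarrow> bool" where
  "power_avoiding d F \<longleftrightarrow> irreducible F \<and> lead_coeff F = 1 \<and> d dvd degree F \<and>
     (\<forall>(a::int) p y. prime p \<longrightarrow> p dvd d \<longrightarrow> poly F (of_int a) \<noteq> y ^ p)"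

lemma power_avoiding_unicritical:
  assumes F: "power_avoiding d F" and d: "d > 0"
  shows "power_avoiding d (F \<circ>\<^sub>p unicritical d (of_int c))"
proof -
  have irr: "irreducible F" and monic: "lead_coeff F = 1" and deg: "d dvd degree F"
    using F by (simp_all add: power_avoiding_def)
  have avoid: "poly F (of_int a) \<noteq> y ^ p" if "prime p" "p dvd d" for a :: int and p y
    using F that unfolding power_avoiding_def by blast
  let ?u = "unicritical d (of_int c)"
  have "even (degree F)" if "even d" using deg that by (rule dvd_trans[rotated])
  hence "irreducible (F \<circ>\<^sub>p ?u)"
    using reducible_pcompose_unicritical[OF irr monic d, of "of_int c"] avoid by blast
  moreover have "lead_coeff (F \<circ>\<^sub>p ?u) = 1"
    using lead_coeff_comp[of ?u F] d monic lead_coeff_unicritical[OF d, of "of_int c"]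
    by (simp add: degree_unicritical)
  moreover have "poly (F \<circ>\<^sub>p ?u) (of_int a) \<noteq> y ^ p" if "prime p" "p dvd d" for a :: int and p y
    using avoid[OF that, of "a ^ d + c" y] by (simp add: poly_pcompose poly_unicritical)
  moreover have "d dvd degree (F \<circ>\<^sub>p ?u)"
    using d by (simp add: degree_pcompose degree_unicritical)
  ultimately show ?thesis unfolding power_avoiding_def by blast
qed

lemma power_avoiding_comp_semigroup:
  assumes "g \<in> comp_semigroup {unicritical d (of_int (c i)) | i. i \<in> I}" "power_avoiding d F" "d > 0"
  shows "power_avoiding d (F \<circ>\<^sub>p g)"
  using assms(1,2)
proof (induction g arbitrary: F rule: comp_semigroup.induct)
  case (gen g)
  thus ?case using power_avoiding_unicritical assms(3) by blast
next
  case (comp f g)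
  thus ?case by (simp add: pcompose_assoc)
qed

lemma irreducible_imp_no_root:
  fixes q :: "'a::field poly"
  assumes "irreducible q" "degree q \<ge> 2"
  shows "poly q x \<noteq> 0"
proof
  assume "poly q x = 0"
  then obtain r where r: "q = [:-x, 1:] * r" by (auto simp: poly_eq_0_iff_dvd)
  hence "r dvd 1" using irreducibleD[OF assms(1) r] by (auto simp: poly_dvd_1)
  hence "degree r = 0" by (auto simp: poly_dvd_1)
  hence "degree q \<le> 1" using r degree_mult_le[of "[:-x, 1:]" r] by simp
  thus False using assms(2) by simp
qed

lemma poly_iterate_Suc: "poly_iterate f (Suc n) = poly_iterate f n \<circ>\<^sub>p f"
  by (induction n) (simp_all add: poly_iterate_def pcompose_pCons pcompose_assoc)

lemma poly_iterate_1: "poly_iterate f (Suc 0) = f"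
  by (simp add: poly_iterate_def)

lemma poly_iterate_unicritical_int:
  "poly (poly_iterate (unicritical d (of_int k)) n) (of_int z) = of_int (((\<lambda>z. z ^ d + k) ^^ n) z)"
proof (induction n arbitrary: z)
  case 0
  show ?case by (simp add: poly_iterate_def)
next
  case (Suc n)
  show ?case
    using Suc.IH[of "z ^ d + k"]
    by (simp add: poly_iterate_Suc poly_pcompose poly_unicritical funpow_Suc_right del: funpow.simps)
qed

lemma monic_poly_iterate_unicritical:
  assumes "d > 0"
  shows "degree (poly_iterate (unicritical d c) n) = d ^ n"
    and "lead_coeff (poly_iterate (unicritical d c) n) = 1"
proof (induction n)
  case 0
  show "degree (poly_iterate (unicritical d c) 0) = d ^ 0" "lead_coeff (poly_iterate (unicritical d c) 0) = 1"
    by (simp_all add: poly_iterate_def)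
next
  case (Suc n)
  show "degree (poly_iterate (unicritical d c) (Suc n)) = d ^ Suc n"
    using Suc assms by (simp add: poly_iterate_Suc degree_pcompose degree_unicritical)
  show "lead_coeff (poly_iterate (unicritical d c) (Suc n)) = 1"
    using Suc assms lead_coeff_comp[of "unicritical d c" "poly_iterate (unicritical d c) n"]
      lead_coeff_unicritical[of d c]
    by (simp add: poly_iterate_Suc degree_unicritical)
qed

text \<open>
  The \<open>m\<close>-th iterate is composed with \<open>f\<close> on the right, so the criterion asks for its value at \<open>k\<close>.
  The values are integers, and an integer that is a \<open>p\<close>-th power in \<open>\<rat>\<close> is one in \<open>\<int>\<close>; this reduces
  everything to integer orbits.
\<close>

lemma power_avoiding_poly_iterate:
  fixes d :: nat and k :: int
  defines "g \<equiv> \<lambda>z. z ^ d + k"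
  assumes irr: "irreducible (unicritical d (of_int k))" and d: "d > 0" and n: "n \<ge> 1"
    and crit: "\<And>m p y. 1 \<le> m \<Longrightarrow> m < n \<Longrightarrow> prime p \<Longrightarrow> p dvd d \<Longrightarrow> (g ^^ m) k \<noteq> y ^ p"
    and avoid: "\<And>a p y. prime p \<Longrightarrow> p dvd d \<Longrightarrow> (g ^^ n) a \<noteq> y ^ p"
  shows "power_avoiding d (poly_iterate (unicritical d (of_int k)) n)"
proof -
  define f where "f = unicritical d (of_int k)"
  have int_power: "poly (poly_iterate f m) (of_int a) \<noteq> y ^ p"
    if no: "\<And>z. (g ^^ m) a \<noteq> z ^ p" and p: "prime p" for m p a y
  proof
    assume "poly (poly_iterate f m) (of_int a) = y ^ p"
    hence eq: "y ^ p = of_int ((g ^^ m) a)" by (simp add: f_def g_def poly_iterate_unicritical_int)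
    then obtain z where "y = of_int z" using rat_power_of_int_is_int p prime_gt_0_nat by blast
    hence "z ^ p = (g ^^ m) a" using eq by (metis of_int_eq_iff of_int_power)
    thus False using no by metis
  qed
  have deg: "d dvd degree (poly_iterate f m)" if "m \<ge> 1" for m
    using that d by (simp add: f_def monic_poly_iterate_unicritical dvd_power)
  have "irreducible (poly_iterate f m)" if "1 \<le> m" "m \<le> n" for m
    using that
  proof (induction m rule: dec_induct)
    case base
    thus ?case using irr by (simp add: poly_iterate_1 f_def)
  next
    case (step m)
    show ?case
    proof (rule ccontr)
      assume "\<not> irreducible (poly_iterate f (Suc m))"
      hence "\<exists>p y. prime p \<and> p dvd d \<and> poly (poly_iterate f m) (of_int k) = y ^ p"
        using step d deg[of m] monic_poly_iterate_unicritical(2)[OF d]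
        unfolding poly_iterate_Suc by (intro reducible_pcompose_unicritical) (auto simp: f_def)
      thus False using int_power crit step by fastforce
    qed
  qed
  hence "irreducible (poly_iterate f n)" using n by blast
  moreover have "poly (poly_iterate f n) (of_int a) \<noteq> y ^ p" if "prime p" "p dvd d" for a p y
    using int_power[OF avoid] that by blast
  moreover have "lead_coeff (poly_iterate f n) = 1"
    unfolding f_def by (rule monic_poly_iterate_unicritical(2)[OF d])
  ultimately show ?thesis
    unfolding power_avoiding_def f_def[symmetric] using deg[OF n] by blast
qed

lemma irreducible_unicritical_no_int_root:
  fixes k z :: int
  assumes "irreducible (unicritical d (of_int k))" "d \<ge> 2"
  shows "z ^ d + k \<noteq> 0"
proof -
  have "poly (unicritical d (of_int k)) (of_int z) \<noteq> 0"
    using assms by (intro irreducible_imp_no_root) (auto simp: degree_unicritical)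
  moreover have "poly (unicritical d (of_int k)) (of_int z) = of_int (z ^ d + k)"
    by (simp add: poly_unicritical)
  ultimately show ?thesis by (metis of_int_0)
qed

lemma poly_unicritical_int:
  "poly (unicritical d (of_int k)) (of_int y ^ p) = of_int ((y ^ p) ^ d + k)"
  by (simp add: poly_unicritical)

lemma powered_fixed_pointI:
  assumes "prime p" "p dvd d" "(y ^ p) ^ d + k = y ^ p"
  shows "has_powered_fixed_point d (of_int k)"
  unfolding has_powered_fixed_point_def
  using assms poly_unicritical_int[of d k y p] by (metis of_int_power)

theorem third_iterate_power_avoiding:
  fixes k :: int
  assumes irr: "irreducible (unicritical d (of_int k))" and d: "d \<ge> 3"
    and no_fix: "\<not> has_powered_fixed_point d (of_int k)"
  shows "power_avoiding d (poly_iterate (unicritical d (of_int k)) 3)"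
proof -
  define g where "g = (\<lambda>z. z ^ d + k)"
  have noroot: "z ^ d + k \<noteq> 0" for z using irreducible_unicritical_no_int_root[OF irr] d by simp
  have k: "k \<noteq> 0" "k \<noteq> -1" using noroot[of 0] noroot[of 1] d by (auto simp: power_0_left)
  have g3: "(g ^^ 3) a \<noteq> y ^ p" if p: "prime p" "p dvd d" for a y p
  proof
    assume "(g ^^ 3) a = y ^ p"
    hence eq: "y ^ p = g (g a) ^ d + k" by (simp add: eval_nat_numeral g_def)
    have "g a = g (g a)"
      using third_iterate_power[OF d p(2,1) noroot refl refl] eq by (simp add: g_def)
    hence "g (y ^ p) = y ^ p" using eq by (metis g_def)
    thus False using no_fix powered_fixed_pointI[OF p] by (auto simp: g_def)
  qed
  have "(g ^^ m) k \<noteq> y ^ p" if m: "1 \<le> m" "m < 3" and p: "prime p" "p dvd d" for m p y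
  proof -
    consider "m = 1" | "m = 2" using m by linarith
    thus ?thesis
    proof cases
      case 1
      thus ?thesis using critical_orbit_2[of d p k y] d p k 1 by (auto simp: g_def)
    next
      case 2
      \<comment> \<open>The next orbit value of \<open>k = f(0)\<close> is a third iterate at \<open>0\<close>.\<close>
      have "g 0 = k" using d by (simp add: g_def power_0_left)
      thus ?thesis using g3[OF p, of 0 y] 2 by (simp add: eval_nat_numeral)
    qed
  qed
  thus ?thesis using power_avoiding_poly_iterate[OF irr] d g3 by (simp add: g_def)
qed

theorem fourth_iterate_power_avoiding:
  fixes k :: int
  assumes irr: "irreducible (unicritical 2 (of_int k))"
    and no_fix: "\<not> has_powered_fixed_point 2 (of_int k)"
    and no_cycle: "\<not> has_powered_2_cycle 2 (of_int k)"
  shows "power_avoiding 2 (poly_iterate (unicritical 2 (of_int k)) 4)"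
proof -
  define g where "g = (\<lambda>z. z ^ 2 + k)"
  have noroot: "z ^ 2 + k \<noteq> 0" for z using irreducible_unicritical_no_int_root[OF irr] by simp
  have k: "k \<noteq> 0" "k \<noteq> -1" using noroot[of 0] noroot[of 1] by auto
  have fix': "g (y ^ 2) \<noteq> y ^ 2" for y
    using no_fix powered_fixed_pointI[of 2 2 y k] by (auto simp: g_def)
  have g4: "(g ^^ 4) a \<noteq> y ^ 2" for a y
  proof
    assume "(g ^^ 4) a = y ^ 2"
    hence eq: "y ^ 2 = g (g (g (g a)))" by (simp add: eval_nat_numeral)
    have "g (g a) = g (g (g a)) \<or> g a = g (g (g a))"
      using fourth_iterate_square[OF noroot refl refl refl] eq by (simp add: g_def)
    thus False
    proof
      assume "g (g a) = g (g (g a))"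
      thus False using eq fix' by metis
    next
      assume "g a = g (g (g a))"
      hence "g (g (y ^ 2)) = y ^ 2" using eq by metis
      hence "has_powered_2_cycle 2 (of_int k)"
        unfolding has_powered_2_cycle_def using fix'[of y]
        by (intro exI[of _ "of_int y"] exI[of _ 2])
           (simp add: poly_unicritical g_def flip: of_int_power of_int_add)
      thus False using no_cycle by blast
    qed
  qed
  have "(g ^^ m) k \<noteq> y ^ 2" if m: "1 \<le> m" "m < 4" for m y
  proof -
    consider "m = 1" | "m = 2" | "m = 3" using m by linarith
    thus ?thesis
    proof cases
      case 1
      thus ?thesis using critical_orbit_2[of 2 2 k y] k 1 by (auto simp: g_def)
    next
      case 2
      thus ?thesis using critical_orbit_3_square[OF k, of y] 2 by (simp add: eval_nat_numeral g_def)
    next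
      case 3
      \<comment> \<open>The third iterate at \<open>k = f(0)\<close> is a fourth iterate at \<open>0\<close>.\<close>
      have "g 0 = k" by (simp add: g_def)
      thus ?thesis using g4[of 0 y] 3 by (simp add: eval_nat_numeral)
    qed
  qed
  moreover have two: "p = 2" if "prime p" "p dvd 2" for p :: nat
    using primes_dvd_imp_eq[OF that(1) two_is_prime_nat that(2)] .
  ultimately have crit: "(g ^^ m) k \<noteq> y ^ p" if "1 \<le> m" "m < 4" "prime p" "p dvd 2" for m p y
    using that by blast
  have avoid: "(g ^^ 4) a \<noteq> y ^ p" if "prime p" "p dvd 2" for a p y
    using g4 two[OF that] by simp
  show ?thesis
    using crit avoid by (intro power_avoiding_poly_iterate[OF irr]) (auto simp: g_def)
qed

theorem proposition3p5:
  fixes d s :: nat and c :: "nat \<Rightarrow> int" and G :: "rat poly set"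
  assumes "d \<ge> 2"
    and "G = comp_semigroup {unicritical d (of_int (c i)) | i. i \<in> {1..s}}"
    and "\<exists>h\<in>G. irreducible h"
  shows "\<exists>(a::rat) f. f = unicritical d a \<and> f \<in> G \<and> irreducible f \<and>
    (d = 2 \<longrightarrow>
      (\<forall>h\<in>{poly_iterate f 4 \<circ>\<^sub>p g | g. g \<in> G}. irreducible h) \<or>
      has_powered_fixed_point d a \<or> has_powered_2_cycle d a) \<and>
    (d \<ge> 3 \<longrightarrow>
      (\<forall>h\<in>{poly_iterate f 3 \<circ>\<^sub>p g | g. g \<in> G}. irreducible h) \<or>
      has_powered_fixed_point d a)"
proof -
  let ?S = "{unicritical d (of_int (c i)) | i. i \<in> {1..s}}"
  have "degree f > 0" if "f \<in> ?S" for f using that assms(1) by (auto simp: degree_unicritical)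
  then obtain f where f: "f \<in> ?S" "irreducible f"
    using assms(2,3) irreducible_generator[of _ ?S] by blast
  then obtain k where fk: "f = unicritical d (of_int k)" by blast
  have fG: "f \<in> G" unfolding assms(2) using f(1) by (rule comp_semigroup.gen)
  have irreducible_comp: "irreducible (F \<circ>\<^sub>p g)" if "power_avoiding d F" "g \<in> G" for F g
  proof -
    have "power_avoiding d (F \<circ>\<^sub>p g)"
      using that(2) assms(1) unfolding assms(2)
      by (intro power_avoiding_comp_semigroup[OF _ that(1), where c = c and I = "{1..s}"]) simp_all
    thus ?thesis by (simp add: power_avoiding_def)
  qed
  have "\<forall>h\<in>{poly_iterate f 4 \<circ>\<^sub>p g | g. g \<in> G}. irreducible h"
    if "d = 2" "\<not> has_powered_fixed_point d (of_int k)" "\<not> has_powered_2_cycle d (of_int k)"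
    using fourth_iterate_power_avoiding[of k] irreducible_comp that f fk by auto
  moreover have "\<forall>h\<in>{poly_iterate f 3 \<circ>\<^sub>p g | g. g \<in> G}. irreducible h"
    if "d \<ge> 3" "\<not> has_powered_fixed_point d (of_int k)"
    using third_iterate_power_avoiding[of d k] irreducible_comp that f fk by auto
  ultimately show ?thesis using fk fG f(2) by (intro exI[of _ "of_int k"] exI[of _ f]) blast
qed

end
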